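(* Let $H$ be a real Hilbert space and let $A:H\to 2^H$ be a maximal monotone operator with $A^{-1}(\mathbf{0}) := \{x\in H : \mathbf{0}\in A(x)\}\neq\emptyset$. Let $\lambda>0$ and let $\theta,\delta\in\mathbb{R}$ satisfy $$0\le\theta<\tfrac13,\qquad \frac{3\theta-1}{3+4\theta}<\delta\le 0 .$$ Let $x_{-1},x_0,y_0\in H$ be arbitrary, and let $\{x_n\}$ and $\{y_n\}$ be generated, for $n=0,1,2,\dots$, by $$x_{n+1}=J_\lambda^A(y_n),\qquad y_{n+1}=x_{n+1}+\theta(x_{n+1}-x_n)+\delta(x_n-x_{n-1}).$$ Then $\{x_n\}$ converges weakly to a point of $A^{-1}(\mathbf{0})$.
   Context: $H$ is a real Hilbert space with inner product $\langle\cdot,\cdot\rangle$ and induced norm $\|\cdot\|$. A set-valued operator $A:H\to 2^H$ is monotone if $\langle x-y,f-g\rangle\ge 0$ for all $x,y\in H$, $f\in A(x)$, $g\in A(y)$; it is maximal monotone if, in addition, its graph $\{(x,f)\in H\times H: f\in A(x)\}$ is not properly contained in the graph of any other monotone operator. For $\lambda>0$, the resolvent of a maximal monotone $A$ is the single-valued, everywhere defined map $J_\lambda^A=(I+\lambda A)^{-1}:H\to H$, i.e. $J_\lambda^A(x)$ is the unique $z\in H$ with $x\in z+\lambda A(z)$. *)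

theory Defs
  imports "HOL-Analysis.Analysis"
begin

text \<open>
  A real Hilbert space is a type of sort \<open>{real_inner, complete_space}\<close>, and a set-valued
  operator on it is a function of type \<open>'a \<Rightarrow> 'a set\<close>.
\<close>

definition op_graph :: "('a \<Rightarrow> 'b set) \<Rightarrow> ('a \<times> 'b) set" where
  "op_graph A = {(x, f). f \<in> A x}"

definition monotone_operator :: "('a::real_inner \<Rightarrow> 'a set) \<Rightarrow> bool" where
  "monotone_operator A \<longleftrightarrow>
     (\<forall>x y. \<forall>f\<in>A x. \<forall>g\<in>A y. inner (x - y) (f - g) \<ge> 0)"

definition maximal_monotone :: "('a::real_inner \<Rightarrow> 'a set) \<Rightarrow> bool" where
  "maximal_monotone A \<longleftrightarrow>
     monotone_operator A \<and> (\<nexists>B. monotone_operator B \<and> op_graph A \<subset> op_graph B)"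

definition op_zeros :: "('a::zero \<Rightarrow> 'a set) \<Rightarrow> 'a set" where
  "op_zeros A = {x. 0 \<in> A x}"

text \<open>
  The description is meaningful only when such a \<open>z\<close> exists and is unique, as is the case for
  maximal monotone \<open>A\<close> and \<open>c > 0\<close> (Minty's theorem).
\<close>

definition resolvent :: "real \<Rightarrow> ('a::real_inner \<Rightarrow> 'a set) \<Rightarrow> 'a \<Rightarrow> 'a" where
  "resolvent c A x = (THE z. x \<in> (\<lambda>f. z + c *\<^sub>R f) ` A z)"

definition converges_weakly :: "(nat \<Rightarrow> 'a::real_normed_vector) \<Rightarrow> 'a \<Rightarrow> bool" where
  "converges_weakly X l \<longleftrightarrow>
     (\<forall>\<phi>::'a \<Rightarrow> real. bounded_linear \<phi> \<longrightarrow> (\<lambda>n. \<phi> (X n)) \<longlonglongrightarrow> \<phi> l)"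

end

theory Submission
  imports Defs
begin

text \<open>
  Since the coefficients of \<open>y\<^sub>n\<close> sum to one, \<open>\<parallel>y\<^sub>n - z\<parallel>\<^sup>2\<close> expands into the squared distances of the iterates
  to a zero \<open>z\<close> and to each other. With \<open>d = - \<delta>\<close> and \<open>u\<^sub>k = x\<^sub>k\<^sub>+\<^sub>1 - x\<^sub>k\<close> this makes
  \<open>\<parallel>x\<^sub>k\<^sub>+\<^sub>2 - z\<parallel>\<^sup>2 - \<theta>\<parallel>x\<^sub>k\<^sub>+\<^sub>1 - z\<parallel>\<^sup>2 + d\<parallel>x\<^sub>k - z\<parallel>\<^sup>2 + 2(\<theta> + d)\<parallel>u\<^sub>k\<^sub>+\<^sub>1\<parallel>\<^sup>2 + d\<parallel>u\<^sub>k\<parallel>\<^sup>2\<close>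
  decrease by at least \<open>(1 - 3\<theta> - 3d)\<parallel>u\<^sub>k\<^sub>+\<^sub>2\<parallel>\<^sup>2\<close>. The hypothesis on \<open>\<delta>\<close> gives \<open>3\<theta> + 3d < 1\<close>, so the
  iterates are bounded, \<open>u\<^sub>k \<longlonglongrightarrow> 0\<close>, the distances to zeros converge, and Opial's argument applies.

  Minty's theorem reduces to a common point of the balls \<open>\<langle>z - a, z - (y - c f)\<rangle> \<le> 0\<close> with \<open>(a, f)\<close> in the
  graph: finite families are handled by maximising a concave function over a convex hull, and a
  finite intersection property passes to arbitrary families. The latter also replaces weak sequential compactness: it
  yields a common point of the closed convex hulls of the tails of a bounded sequence.
\<close>

section \<open>Intersections of closed convex sets\<close>

text \<open>
  If the infimum of the norm on a finite intersection is almost the supremum over all of them,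
  points of nearly minimal norm in that intersection are close by the parallelogram law.
\<close>

lemma fip_closed_convex:
  fixes \<C> :: "'a::{real_inner, complete_space} set set"
  assumes closed: "\<And>C. C \<in> \<C> \<Longrightarrow> closed C" and convex: "\<And>C. C \<in> \<C> \<Longrightarrow> convex C"
    and C0: "C0 \<in> \<C>" "bounded C0"
    and fip: "\<And>\<F>. finite \<F> \<Longrightarrow> \<F> \<subseteq> \<C> \<Longrightarrow> \<Inter>\<F> \<noteq> {}"
  shows "\<Inter>\<C> \<noteq> {}"
proof -
  \<comment> \<open>Cutting with the bounded set \<open>C0\<close> bounds the minimal norms
    \<open>r\<close>, so that their supremum \<open>s\<close> is finite.\<close>
  define I where "I \<F> = C0 \<inter> \<Inter>\<F>" for \<F>
  define T where "T = {\<F>. finite \<F> \<and> \<F> \<subseteq> \<C>}"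
  define r where "r \<F> = infdist 0 (I \<F>)" for \<F>
  have I_ne: "I \<F> \<noteq> {}" if "\<F> \<in> T" for \<F>
    using fip[of "insert C0 \<F>"] C0 that by (auto simp: I_def T_def)
  have I_convex: "convex (I \<F>)" if "\<F> \<in> T" for \<F>
    unfolding I_def using convex C0 that by (intro convex_Int convex_Inter) (auto simp: T_def)
  obtain M where M: "\<And>v. v \<in> C0 \<Longrightarrow> norm v \<le> M"
    using C0 by (auto simp: bounded_iff)
  have r_le: "r \<F> \<le> norm v" if "v \<in> I \<F>" for v \<F>
    using infdist_le[OF that, of 0] by (simp add: r_def)
  have r_bdd: "bdd_above (r ` T)"
  proof (intro bdd_aboveI2)
    fix \<F> assume "\<F> \<in> T"
    then obtain v where "v \<in> I \<F>" using I_ne by blast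
    then show "r \<F> \<le> M" using r_le[of v \<F>] M[of v] by (auto simp: I_def)
  qed
  define s where "s = (SUP \<F>\<in>T. r \<F>)"
  have T_ne: "T \<noteq> {}" by (auto simp: T_def)
  have r_le_s: "r \<F> \<le> s" if "\<F> \<in> T" for \<F>
    unfolding s_def using r_bdd that by (intro cSUP_upper)
  have s_nonneg: "0 \<le> s"
    using r_le_s[of "{}"] infdist_nonneg[of 0 "I {}"] by (simp add: T_def r_def)
  define \<epsilon> where "\<epsilon> n = inverse (real (Suc n))" for n
  have eps: "0 < \<epsilon> n" "\<epsilon> n \<le> 1" for n
    by (auto simp: \<epsilon>_def field_simps)
  have eps_lim: "\<epsilon> \<longlonglongrightarrow> 0"
    unfolding \<epsilon>_def by (rule LIMSEQ_inverse_real_of_nat)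
  have "\<exists>\<F>\<in>T. s - \<epsilon> n < r \<F>" for n
    using less_cSUP_iff[OF T_ne r_bdd, of "s - \<epsilon> n"] eps[of n] by (simp add: s_def[symmetric])
  then obtain F where F: "\<And>n. F n \<in> T" "\<And>n. s - \<epsilon> n < r (F n)" by metis
  \<comment> \<open>Unions make the sets \<open>I (G n)\<close> decrease in \<open>n\<close>, so the
    later points \<open>v m\<close> lie in \<open>I (G n)\<close> as well.\<close>
  define G where "G n = (\<Union>k\<le>n. F k)" for n
  have G_T: "G n \<in> T" for n
    using F(1) by (auto simp: G_def T_def)
  have G_r: "s - \<epsilon> n < r (G n)" for n
  proof -
    have "r (F n) \<le> r (G n)"
      unfolding r_def using I_ne[OF G_T] by (intro infdist_mono) (auto simp: I_def G_def)
    with F(2)[of n] show ?thesis by linarith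
  qed
  have near: "\<exists>v. v \<in> I \<F> \<and> norm v \<le> s + \<epsilon> n" if "\<F> \<in> T" for \<F> n
  proof (rule ccontr)
    assume "\<not> ?thesis"
    then have "s + \<epsilon> n \<le> r \<F>"
      unfolding r_def infdist_def using I_ne[OF that] by (auto intro!: cINF_greatest)
    with r_le_s[OF that] eps[of n] show False by linarith
  qed
  have close: "(norm (u - v))\<^sup>2 \<le> 8 * (2 * s + 1) * \<epsilon> n"
    if "u \<in> I (G n)" "v \<in> I (G n)" "norm u \<le> s + \<epsilon> n" "norm v \<le> s + \<epsilon> n" for u v n
  proof -
    define t where "t = r (G n)"
    have t: "0 \<le> t" "t \<le> s" "s - \<epsilon> n < t"
      using r_le_s[OF G_T] G_r by (auto simp: t_def r_def infdist_nonneg)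
    have "(1/2) *\<^sub>R u + (1/2) *\<^sub>R v \<in> I (G n)"
      using convexD[OF I_convex[OF G_T] that(1,2), of "1/2" "1/2"] by simp
    then have "t \<le> norm ((1/2) *\<^sub>R u + (1/2) *\<^sub>R v)"
      unfolding t_def by (rule r_le)
    also have "\<dots> = norm (u + v) / 2"
      by (simp flip: scaleR_right_distrib)
    finally have "(2 * t)\<^sup>2 \<le> (norm (u + v))\<^sup>2"
      using t(1) by (intro power_mono) auto
    moreover have "(norm u)\<^sup>2 \<le> (s + \<epsilon> n)\<^sup>2" "(norm v)\<^sup>2 \<le> (s + \<epsilon> n)\<^sup>2"
      using that by (auto intro!: power_mono)
    moreover have "(norm (u - v))\<^sup>2 = 2 * (norm u)\<^sup>2 + 2 * (norm v)\<^sup>2 - (norm (u + v))\<^sup>2"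
      by (simp add: power2_norm_eq_inner algebra_simps inner_commute)
    ultimately have "(norm (u - v))\<^sup>2 \<le> 4 * (s + \<epsilon> n)\<^sup>2 - (2 * t)\<^sup>2" by linarith
    also have "\<dots> = 4 * ((s + \<epsilon> n - t) * (s + \<epsilon> n + t))"
      by (simp add: power2_eq_square algebra_simps)
    \<comment> \<open>From \<open>s - t < \<epsilon> n\<close> the first factor is below
      \<open>2 * \<epsilon> n\<close>; from \<open>t \<le> s\<close> and
      \<open>\<epsilon> n \<le> 1\<close> the second is at most \<open>2 * s + 1\<close>.\<close>
    also have "\<dots> \<le> 4 * ((2 * \<epsilon> n) * (2 * s + 1))"
      using t eps[of n] by (intro mult_left_mono mult_mono) auto
    finally show ?thesis by (simp add: mult_ac)
  qed
  obtain v where v: "\<And>n. v n \<in> I (G n)" "\<And>n. norm (v n) \<le> s + \<epsilon> n"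
    using choice[OF allI, of "\<lambda>n v. v \<in> I (G n) \<and> norm v \<le> s + \<epsilon> n", OF near[OF G_T]] by auto
  have small: "(\<lambda>n. sqrt (8 * (2 * s + 1) * \<epsilon> n)) \<longlonglongrightarrow> 0"
    using tendsto_real_sqrt[OF tendsto_mult_right_zero[OF eps_lim, of "8 * (2 * s + 1)"]] by simp
  have v_close: "norm (v m - v n) \<le> sqrt (8 * (2 * s + 1) * \<epsilon> n)" if "n \<le> m" for m n
  proof (intro real_le_rsqrt close)
    show "v m \<in> I (G n)" using v(1)[of m] that by (force simp: I_def G_def)
    have "\<epsilon> m \<le> \<epsilon> n" using that by (simp add: \<epsilon>_def field_simps)
    then show "norm (v m) \<le> s + \<epsilon> n" using v(2)[of m] by linarith
  qed (use v in auto)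
  have "Cauchy v"
  proof (rule metric_CauchyI)
    fix e :: real assume "0 < e"
    then obtain N where N: "sqrt (8 * (2 * s + 1) * \<epsilon> N) < e / 2"
      using order_tendstoD(2)[OF small, of "e / 2"] eventually_sequentially by auto
    have "dist (v m) (v n) < e" if "m \<ge> N" "n \<ge> N" for m n
      using v_close[OF that(1)] v_close[OF that(2)] N dist_triangle2[of "v m" "v n" "v N"]
      by (simp add: dist_norm)
    then show "\<exists>N. \<forall>m\<ge>N. \<forall>n\<ge>N. dist (v m) (v n) < e" by blast
  qed
  then obtain p where p: "v \<longlonglongrightarrow> p"
    using Cauchy_convergent_iff convergent_def by blast
  have "p \<in> C" if C: "C \<in> \<C>" for C
  proof -
    \<comment> \<open>Adding \<open>C\<close> to \<open>G n\<close> gives nearly minimal points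
      \<open>w n\<close> of \<open>C\<close> that still lie in \<open>I (G n)\<close>; by
      \<open>close\<close> they share the limit \<open>p\<close>.\<close>
    have CG: "insert C (G n) \<in> T" for n
      using C G_T[of n] by (auto simp: T_def)
    obtain w where w: "\<And>n. w n \<in> I (insert C (G n))" "\<And>n. norm (w n) \<le> s + \<epsilon> n"
      using choice[OF allI, of "\<lambda>n w. w \<in> I (insert C (G n)) \<and> norm w \<le> s + \<epsilon> n", OF near[OF CG]]
      by auto
    have "norm (v n - w n) \<le> sqrt (8 * (2 * s + 1) * \<epsilon> n)" for n
      using v[of n] w[of n] by (intro real_le_rsqrt close) (auto simp: I_def)
    then have "(\<lambda>n. v n - w n) \<longlonglongrightarrow> 0"
      using small by (intro Lim_null_comparison[OF _ small]) auto
    from tendsto_diff[OF p this] have "w \<longlonglongrightarrow> p" by simp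
    moreover have "w n \<in> C" for n using w(1)[of n] by (simp add: I_def)
    ultimately show ?thesis
      using closed[OF C] closed_sequentially by blast
  qed
  then show ?thesis by blast
qed

section \<open>Minty's theorem and the resolvent\<close>

text \<open>
  Writing \<open>c = (a + b) / 2\<close>, the function \<open>\<Sum>t\<^sub>i \<langle>a\<^sub>i, b\<^sub>i\<rangle> - \<parallel>\<Sum>t\<^sub>i c\<^sub>i\<parallel>\<^sup>2\<close> on the simplex is dual to the problem of
  minimising the largest \<open>\<langle>z - a\<^sub>i, z - b\<^sub>i\<rangle>\<close>: its value at a maximiser bounds all of them at
  \<open>z = \<Sum>t\<^sub>i c\<^sub>i\<close>, and monotonicity makes it nonpositive.
\<close>

lemma finite_debrunner_flor:
  fixes S :: "('a::real_inner \<times> 'a) set"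
  assumes "finite S"
    and mono: "\<And>a b a' b'. (a, b) \<in> S \<Longrightarrow> (a', b') \<in> S \<Longrightarrow> inner (a - a') (b - b') \<le> 0"
  shows "\<exists>z. \<forall>(a, b)\<in>S. inner (z - a) (z - b) \<le> 0"
proof (cases "S = {}")
  case False
  \<comment> \<open>The third coordinate makes the weighted sum of the inner products linear on the
    hull, so \<open>g\<close> is concave there.\<close>
  define P where "P = (\<lambda>(a, b). (a, b, inner a b)) ` S"
  define K where "K = convex hull P"
  define g :: "'a \<times> 'a \<times> real \<Rightarrow> real"
    where "g q = snd (snd q) - (norm ((1/2) *\<^sub>R (fst q + fst (snd q))))\<^sup>2" for q
  have "compact K" "K \<noteq> {}"
    using assms(1) False by (auto simp: K_def P_def intro!: finite_imp_compact_convex_hull)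
  moreover have "continuous_on K g"
    unfolding g_def by (intro continuous_intros)
  ultimately have "\<exists>q\<in>K. \<forall>q'\<in>K. g q' \<le> g q"
    by (rule continuous_attains_sup)
  then obtain q where "q \<in> K" and q_max: "\<And>q'. q' \<in> K \<Longrightarrow> g q' \<le> g q"
    by auto
  obtain a b s where q: "q = (a, b, s)" by (metis prod_cases3)
  have half: "convex {(a', b', s'). c + s' - inner u b' - inner a' v \<le> 0}" for c u v
  proof -
    have "{(a', b', s'). c + s' - inner u b' - inner a' v \<le> 0}
        = {q. inner (- v, - u, 1) q \<le> (- c :: real)}"
      by (auto simp: inner_commute algebra_simps)
    then show ?thesis by (simp add: convex_halfspace_le)
  qed
  have s_le: "s \<le> inner a b"
  proof -
    \<comment> \<open>For two vertices the expression is \<open>inner (a' - a'') (b' - b'')\<close>.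
      Being affine in each vertex separately, it stays nonpositive when first one and then both are
      replaced by \<open>q\<close>, where it reads \<open>2 * (s - inner a b)\<close>.\<close>
    have vertex: "inner a' b' + s - inner a' b - inner a b' \<le> 0" if "(a', b') \<in> S" for a' b'
    proof -
      have "K \<subseteq> {(a'', b'', s''). inner a' b' + s'' - inner a' b'' - inner a'' b' \<le> 0}"
        unfolding K_def
      proof (rule hull_minimal[where S = convex, OF _ half])
        show "P \<subseteq> {(a'', b'', s''). inner a' b' + s'' - inner a' b'' - inner a'' b' \<le> 0}"
          using mono[OF that] by (fastforce simp: P_def algebra_simps)
      qed
      with \<open>q \<in> K\<close> q show ?thesis by auto
    qed
    have "K \<subseteq> {(a', b', s'). s + s' - inner a b' - inner a' b \<le> 0}"
      unfolding K_def
    proof (rule hull_minimal[where S = convex, OF _ half])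
      show "P \<subseteq> {(a', b', s'). s + s' - inner a b' - inner a' b \<le> 0}"
        using vertex by (fastforce simp: P_def algebra_simps)
    qed
    with \<open>q \<in> K\<close> q show ?thesis by auto
  qed
  define z where "z = (1/2) *\<^sub>R (a + b)"
  have gq: "g q \<le> 0"
  proof -
    have "(norm z)\<^sup>2 - inner a b = (norm ((1/2) *\<^sub>R (a - b)))\<^sup>2"
      by (simp add: z_def power2_norm_eq_inner algebra_simps inner_commute)
    then have "inner a b \<le> (norm z)\<^sup>2"
      using zero_le_power2[of "norm ((1/2) *\<^sub>R (a - b))"] by linarith
    with s_le show ?thesis by (simp add: g_def q z_def)
  qed
  have "inner (z - a') (z - b') \<le> 0" if ab: "(a', b') \<in> S" for a' b'
  proof -
    define c where "c = (1/2) *\<^sub>R (a' + b')"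
    \<comment> \<open>\<open>D\<close> is the derivative of \<open>g\<close> at \<open>q\<close>
      towards the vertex of \<open>(a', b')\<close>. Maximality of \<open>q\<close> makes it
      nonpositive as \<open>t\<close> tends to 0.\<close>
    define D where "D = inner a' b' - s - 2 * inner z (c - z)"
    have bound: "D \<le> t * (norm (c - z))\<^sup>2" if t: "0 < t" "t \<le> 1" for t :: real
    proof -
      have "(a', b', inner a' b') \<in> K"
        unfolding K_def P_def using ab by (intro hull_inc) force
      with \<open>q \<in> K\<close> have "(1 - t) *\<^sub>R q + t *\<^sub>R (a', b', inner a' b') \<in> K"
        using t by (intro convexD) (auto simp: K_def convex_convex_hull)
      note q_max[OF this]
      moreover have "(1/2) *\<^sub>R (((1 - t) *\<^sub>R a + t *\<^sub>R a') + ((1 - t) *\<^sub>R b + t *\<^sub>R b'))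
          = (1 - t) *\<^sub>R z + t *\<^sub>R c"
        by (simp add: z_def c_def scaleR_add_right add_ac)
      ultimately have "(1 - t) * s + t * inner a' b' - (norm ((1 - t) *\<^sub>R z + t *\<^sub>R c))\<^sup>2
          \<le> s - (norm z)\<^sup>2"
        by (simp add: g_def q z_def[symmetric] del: scaleR_add_right)
      moreover have "(1 - t) *\<^sub>R z + t *\<^sub>R c = z + t *\<^sub>R (c - z)"
        by (simp add: algebra_simps)
      moreover have "(norm (z + t *\<^sub>R (c - z)))\<^sup>2
          = (norm z)\<^sup>2 + 2 * t * inner z (c - z) + t\<^sup>2 * (norm (c - z))\<^sup>2"
        unfolding power2_norm_eq_inner
        by (simp only: inner_add_left inner_add_right inner_scaleR_left inner_scaleR_right
            inner_commute[of "c - z" z] power2_eq_square) (simp add: algebra_simps)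
      ultimately have "t * D \<le> t * (t * (norm (c - z))\<^sup>2)"
        by (simp add: D_def power2_eq_square algebra_simps)
      with t show ?thesis by simp
    qed
    have "((\<lambda>t. t * (norm (c - z))\<^sup>2) \<longlongrightarrow> 0 * (norm (c - z))\<^sup>2) (at_right 0)"
      by (intro tendsto_intros)
    moreover have "eventually (\<lambda>t. D \<le> t * (norm (c - z))\<^sup>2) (at_right (0::real))"
      using bound by (auto simp: eventually_at_right_field intro!: exI[of _ 1])
    ultimately have "D \<le> 0"
      using tendsto_lowerbound[of _ 0 "at_right (0::real)"] by fastforce
    moreover have "inner (z - a') (z - b') = D + g q"
    proof -
      have "inner (z - a') (z - b') = (norm z)\<^sup>2 - 2 * inner z c + inner a' b'"
        by (simp add: c_def power2_norm_eq_inner algebra_simps inner_commute)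
      moreover have "g q = s - (norm z)\<^sup>2" by (simp add: g_def q z_def)
      ultimately show ?thesis
        by (simp add: D_def power2_norm_eq_inner inner_diff_right algebra_simps)
    qed
    ultimately show ?thesis using gq by linarith
  qed
  then show ?thesis by blast
qed auto

text \<open>Adjoining \<open>(z, g)\<close> to the graph preserves monotonicity, so by maximality
  the pair was there already.\<close>

lemma maximal_monotoneD:
  assumes max: "maximal_monotone A"
    and rel: "\<And>a f. f \<in> A a \<Longrightarrow> inner (z - a) (g - f) \<ge> 0"
  shows "g \<in> A z"
proof (rule ccontr)
  assume "g \<notin> A z"
  define B where "B = A(z := insert g (A z))"
  have rel': "inner (a - z) (f - g) \<ge> 0" if "f \<in> A a" for a f
    using rel[OF that] by (simp add: algebra_simps)
  have "monotone_operator B"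
    using max rel rel' unfolding maximal_monotone_def monotone_operator_def B_def
    by (auto split: if_splits)
  moreover have "op_graph A \<subset> op_graph B"
    using \<open>g \<notin> A z\<close> by (auto simp: op_graph_def B_def)
  ultimately show False using max by (auto simp: maximal_monotone_def)
qed

text \<open>Completing the square around the midpoint of \<open>a\<close> and \<open>b\<close>. This
  makes the constraint sets in Minty's theorem closed, convex and bounded.\<close>

lemma inner_diff_le_0_iff_cball:
  fixes z :: "'a::real_inner"
  shows "inner (z - a) (z - b) \<le> 0 \<longleftrightarrow> z \<in> cball ((1/2) *\<^sub>R (a + b)) (norm (a - b) / 2)"
proof -
  have "inner (z - a) (z - b) = (norm ((1/2) *\<^sub>R (a + b) - z))\<^sup>2 - (norm (a - b) / 2)\<^sup>2"
    unfolding power_divide power2_norm_eq_inner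
    by (simp add: algebra_simps inner_commute) (simp add: field_simps)
  then show ?thesis
    by (auto simp: dist_norm norm_le_square intro: power2_le_imp_le power_mono)
qed

text \<open>By maximality it suffices that \<open>(1 / c) *\<^sub>R (y - z)\<close> is monotonically
  related to every \<open>(a, f)\<close> of the graph; scaled by \<open>c\<close>, this says that
  \<open>z\<close> lies in every ball \<open>C (a, f)\<close>. Passing from \<open>f\<close> to
  \<open>y - c *\<^sub>R f\<close> reverses monotonicity, as \<open>finite_debrunner_flor\<close>
  requires.\<close>

lemma minty:
  fixes A :: "'a::{real_inner, complete_space} \<Rightarrow> 'a set"
  assumes max: "maximal_monotone A" and "c > 0"
  shows "\<exists>z. \<exists>f\<in>A z. y = z + c *\<^sub>R f"
proof -
  define C where "C = (\<lambda>(a, f). {z. inner (z - a) (z - (y - c *\<^sub>R f)) \<le> 0})"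
  have C_ball: "\<exists>m r. C p = cball m r" for p
    by (cases p) (simp add: C_def inner_diff_le_0_iff_cball del: mem_cball, blast)
  have "\<Inter>(C ` op_graph A) \<noteq> {}"
  proof (cases "op_graph A = {}")
    case False
    then obtain p where p: "p \<in> op_graph A" by blast
    show ?thesis
    proof (rule fip_closed_convex)
      show "C p \<in> C ` op_graph A" "bounded (C p)"
        using p C_ball[of p] by auto
    next
      fix \<F> assume "finite \<F>" "\<F> \<subseteq> C ` op_graph A"
      then obtain S where S: "S \<subseteq> op_graph A" "finite S" "\<F> = C ` S"
        by (meson finite_subset_image)
      have "\<exists>z. \<forall>(a, b)\<in>(\<lambda>(a, f). (a, y - c *\<^sub>R f)) ` S. inner (z - a) (z - b) \<le> 0"
      proof (rule finite_debrunner_flor)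
        fix a b a' b'
        assume "(a, b) \<in> (\<lambda>(a, f). (a, y - c *\<^sub>R f)) ` S" "(a', b') \<in> (\<lambda>(a, f). (a, y - c *\<^sub>R f)) ` S"
        then obtain f f' where "(a, f) \<in> S" "(a', f') \<in> S" and b: "b = y - c *\<^sub>R f" "b' = y - c *\<^sub>R f'"
          by auto
        then have f: "f \<in> A a" "f' \<in> A a'"
          using S(1) by (auto simp: op_graph_def)
        have "b - b' = - (c *\<^sub>R (f - f'))"
          by (simp add: b algebra_simps)
        moreover have "inner (a - a') (f - f') \<ge> 0"
          using max f by (auto simp: maximal_monotone_def monotone_operator_def)
        ultimately show "inner (a - a') (b - b') \<le> 0"
          using \<open>c > 0\<close> by simp
      qed (use S in auto)
      then show "\<Inter>\<F> \<noteq> {}"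
        unfolding S(3) C_def by fastforce
    qed (use C_ball in \<open>metis (lifting) imageE closed_cball convex_cball\<close>)+
  qed auto
  then obtain z where z: "\<And>a f. f \<in> A a \<Longrightarrow> inner (z - a) (z - (y - c *\<^sub>R f)) \<le> 0"
    by (auto simp: C_def op_graph_def)
  have "(1 / c) *\<^sub>R (y - z) \<in> A z"
  proof (rule maximal_monotoneD[OF max])
    fix a f assume "f \<in> A a"
    have "(1 / c) *\<^sub>R (y - z) - f = - ((1 / c) *\<^sub>R (z - (y - c *\<^sub>R f)))"
      using \<open>c > 0\<close> by (simp add: algebra_simps)
    then have "inner (z - a) ((1 / c) *\<^sub>R (y - z) - f) = - ((1 / c) * inner (z - a) (z - (y - c *\<^sub>R f)))"
      by (simp only: inner_minus_right inner_scaleR_right)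
    then show "inner (z - a) ((1 / c) *\<^sub>R (y - z) - f) \<ge> 0"
      using z[OF \<open>f \<in> A a\<close>] \<open>c > 0\<close> by (simp add: divide_nonpos_pos)
  qed
  then show ?thesis using \<open>c > 0\<close> by (intro exI[of _ z] bexI) auto
qed

lemma resolvent_unique:
  assumes "monotone_operator A" "c > 0"
    and "f \<in> A z" "g \<in> A w" and eq: "z + c *\<^sub>R f = w + c *\<^sub>R g"
  shows "z = w"
proof -
  have "inner (z - w) (f - g) \<ge> 0"
    using assms by (auto simp: monotone_operator_def)
  moreover have "z - w = - (c *\<^sub>R (f - g))"
    using eq by (simp add: algebra_simps)
  then have "inner (z - w) (z - w) = - (c * inner (z - w) (f - g))"
    by (metis inner_minus_right inner_scaleR_right)
  ultimately have "inner (z - w) (z - w) \<le> 0"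
    using \<open>c > 0\<close> by simp
  then show ?thesis
    by (metis inner_gt_zero_iff linorder_not_less right_minus_eq)
qed

text \<open>Minty's theorem and \<open>resolvent_unique\<close> make the description in
  \<open>resolvent\<close> meaningful, so it unfolds to the inclusion.\<close>

lemma resolvent_mem:
  fixes A :: "'a::{real_inner, complete_space} \<Rightarrow> 'a set"
  assumes max: "maximal_monotone A" and "c > 0"
  shows "(1 / c) *\<^sub>R (y - resolvent c A y) \<in> A (resolvent c A y)"
proof -
  have "\<exists>!z. y \<in> (\<lambda>f. z + c *\<^sub>R f) ` A z"
    using minty[OF assms, of y] resolvent_unique[of A c] assms
    by (auto simp: maximal_monotone_def image_iff)
  from theI'[OF this] obtain f where f: "f \<in> A (resolvent c A y)" "y = resolvent c A y + c *\<^sub>R f"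
    unfolding resolvent_def by blast
  then have "(1 / c) *\<^sub>R (y - resolvent c A y) = f"
    using \<open>c > 0\<close> by (metis add_diff_cancel_left' divide_self_if less_numeral_extra(3) scaleR_one
        scaleR_scaleR times_divide_eq_left mult_1)
  with f show ?thesis by simp
qed

section \<open>Weak convergence through hull points\<close>

text \<open>
  By Hahn--Banach these are the points in the closed convex hulls of all tails of the sequence.
\<close>

definition hull_point :: "(nat \<Rightarrow> 'a::real_normed_vector) \<Rightarrow> 'a \<Rightarrow> bool" where
  "hull_point X p \<longleftrightarrow>
     (\<forall>\<phi> c. bounded_linear \<phi> \<longrightarrow> (\<forall>\<^sub>F n in sequentially. \<phi> (X n) \<le> c) \<longrightarrow> \<phi> p \<le> (c::real))"

text \<open>The closed convex hulls of finitely many tails meet, so \<open>fip_closed_convex\<close>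
  gives a point common to all. A closed half-space containing a tail contains its closed hull, hence
  that point.\<close>

lemma hull_point_exists:
  fixes X :: "nat \<Rightarrow> 'a::{real_inner, complete_space}"
  assumes "bounded (range X)"
  shows "\<exists>p. hull_point X p"
proof -
  define C where "C n = closure (convex hull (X ` {n..}))" for n
  have mem: "X k \<in> C n" if "n \<le> k" for k n
  proof -
    have "X k \<in> convex hull (X ` {n..})" using that by (intro hull_inc) auto
    then show ?thesis unfolding C_def using closure_subset by blast
  qed
  have "\<Inter>(range C) \<noteq> {}"
  proof (rule fip_closed_convex)
    show "C 0 \<in> range C" by simp
    show "bounded (C 0)"
      using assms by (auto simp: C_def atLeast_0 intro!: bounded_convex_hull)
    show "\<Inter>\<F> \<noteq> {}" if \<F>: "finite \<F>" "\<F> \<subseteq> range C" for \<F>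
    proof -
      obtain N where N: "finite N" "\<F> = C ` N"
        using finite_subset_image[OF \<F>] by blast
      \<comment> \<open>This index belongs to every tail of the finite family; the inserted 0 keeps
        \<open>Max\<close> meaningful for empty \<open>N\<close>.\<close>
      then have "X (Max (insert 0 N)) \<in> \<Inter>\<F>"
        by (auto intro!: mem)
      then show ?thesis by blast
    qed
  qed (auto simp: C_def convex_closure)
  then obtain p where p: "\<And>n. p \<in> C n" by blast
  have "\<phi> p \<le> c" if \<phi>: "bounded_linear \<phi>" and ev: "\<forall>\<^sub>F n in sequentially. \<phi> (X n) \<le> c"
    for \<phi> and c :: real
  proof -
    obtain N where N: "\<And>n. n \<ge> N \<Longrightarrow> \<phi> (X n) \<le> c"
      using ev by (auto simp: eventually_sequentially)
    have "closed (\<phi> -` {..c})"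
      using \<phi> by (intro closed_vimage) (auto intro: linear_continuous_on)
    moreover have "convex (\<phi> -` {..c})"
      using \<phi> by (intro convex_linear_vimage) (auto intro: bounded_linear.linear)
    then have "convex hull (X ` {N..}) \<subseteq> \<phi> -` {..c}"
      using N by (intro hull_minimal) auto
    ultimately have "C N \<subseteq> \<phi> -` {..c}"
      unfolding C_def by (intro closure_minimal)
    with p[of N] show ?thesis by auto
  qed
  then show ?thesis by (auto simp: hull_point_def)
qed

lemma hull_point_subseq:
  assumes "hull_point (X \<circ> r) p" "strict_mono r"
  shows "hull_point X p"
  using assms eventually_subseq[of r] by (auto simp: hull_point_def)

lemma hull_point_ge:
  assumes "hull_point X p" "bounded_linear \<phi>" "\<forall>\<^sub>F n in sequentially. c \<le> \<phi> (X n)"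
  shows "(c::real) \<le> \<phi> p"
proof -
  have "- \<phi> p \<le> - c"
    using assms(1)[unfolded hull_point_def, rule_format, of "\<lambda>x. - \<phi> x" "- c"] assms(2,3)
    by (auto intro: bounded_linear_minus)
  then show ?thesis by simp
qed

lemma hull_point_lim:
  assumes "hull_point X p" "bounded_linear \<phi>" "(\<lambda>n. \<phi> (X n)) \<longlonglongrightarrow> (l::real)"
  shows "\<phi> p = l"
proof (rule antisym)
  show "\<phi> p \<le> l"
  proof (rule field_le_epsilon)
    fix e :: real assume "0 < e"
    then have "\<forall>\<^sub>F n in sequentially. \<phi> (X n) < l + e"
      by (intro order_tendstoD(2)[OF assms(3)]) auto
    then have "\<forall>\<^sub>F n in sequentially. \<phi> (X n) \<le> l + e"
      by (rule eventually_mono) auto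
    then show "\<phi> p \<le> l + e"
      using assms(1,2) by (auto simp: hull_point_def)
  qed
  show "l \<le> \<phi> p"
  proof (rule field_le_epsilon)
    fix e :: real assume "0 < e"
    then have "\<forall>\<^sub>F n in sequentially. l - e < \<phi> (X n)"
      by (intro order_tendstoD(1)[OF assms(3)]) auto
    then have "\<forall>\<^sub>F n in sequentially. l - e \<le> \<phi> (X n)"
      by (rule eventually_mono) auto
    from hull_point_ge[OF assms(1,2) this] show "l \<le> \<phi> p + e" by linarith
  qed
qed

text \<open>The difference of the squared distances to two hull points is affine in
  \<open>X n\<close>, so \<open>inner (p - q) (X n)\<close> converges; its limit is the value at
  both points, whence \<open>p = q\<close>. If a functional stayed away from its value at
  \<open>p\<close> along a subsequence, a hull point of that subsequence would be a second
  one.\<close>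

lemma opial:
  fixes X :: "nat \<Rightarrow> 'a::{real_inner, complete_space}"
  assumes bdd: "bounded (range X)"
    and hull: "\<And>p. hull_point X p \<Longrightarrow> p \<in> S"
    and conv: "\<And>z. z \<in> S \<Longrightarrow> convergent (\<lambda>n. (norm (X n - z))\<^sup>2)"
  shows "\<exists>p\<in>S. converges_weakly X p"
proof -
  obtain p where p: "hull_point X p" using hull_point_exists[OF bdd] by blast
  have unique: "q = p" if q: "hull_point X q" for q
  proof -
    have eq: "inner (p - q) (X n)
        = ((norm (X n - q))\<^sup>2 - (norm (X n - p))\<^sup>2 - (norm q)\<^sup>2 + (norm p)\<^sup>2) / 2" for n
      by (simp add: power2_norm_eq_inner algebra_simps inner_commute)
    obtain lp lq where "(\<lambda>n. (norm (X n - p))\<^sup>2) \<longlonglongrightarrow> lp" "(\<lambda>n. (norm (X n - q))\<^sup>2) \<longlonglongrightarrow> lq"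
      using conv hull p q by (meson convergent_def)
    then have "(\<lambda>n. inner (p - q) (X n)) \<longlonglongrightarrow> (lq - lp - (norm q)\<^sup>2 + (norm p)\<^sup>2) / 2"
      unfolding eq by (intro tendsto_intros) simp_all
    note this[THEN hull_point_lim[OF p bounded_linear_inner_right]]
      this[THEN hull_point_lim[OF q bounded_linear_inner_right]]
    then have "inner (p - q) (p - q) = 0"
      by (simp add: inner_diff_right)
    then show ?thesis by simp
  qed
  have upper: "\<forall>\<^sub>F n in sequentially. \<phi> (X n) < c"
    if \<phi>: "bounded_linear \<phi>" and c: "\<phi> p < c" for \<phi> and c :: real
  proof (rule ccontr)
    assume "\<not> ?thesis"
    then have "\<exists>\<^sub>\<infinity>n. c \<le> \<phi> (X n)"
      by (simp add: not_eventually not_less cofinite_eq_sequentially)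
    then obtain r :: "nat \<Rightarrow> nat" where r: "strict_mono r" "\<And>n. c \<le> \<phi> (X (r n))"
      using infinite_enumerate[of "{n. c \<le> \<phi> (X n)}"] by (auto simp: frequently_cofinite)
    have "bounded (range (X \<circ> r))"
      using bdd by (rule bounded_subset) auto
    then obtain q where q: "hull_point (X \<circ> r) q" using hull_point_exists by blast
    then have "q = p" using hull_point_subseq r(1) unique by blast
    moreover have "c \<le> \<phi> q"
      using hull_point_ge[OF q \<phi>] r(2) by simp
    ultimately show False using c by simp
  qed
  have "(\<lambda>n. \<phi> (X n)) \<longlonglongrightarrow> \<phi> p" if \<phi>: "bounded_linear \<phi>" for \<phi> :: "'a \<Rightarrow> real"
  proof (rule order_tendstoI)
    fix c assume "c < \<phi> p"
    then have "\<forall>\<^sub>F n in sequentially. - \<phi> (X n) < - c"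
      using upper[of "\<lambda>x. - \<phi> x" "- c"] \<phi> by (auto intro: bounded_linear_minus)
    then show "\<forall>\<^sub>F n in sequentially. c < \<phi> (X n)" by simp
  qed (use upper \<phi> in blast)
  then show ?thesis using hull[OF p] by (auto simp: converges_weakly_def)
qed

section \<open>Lyapunov analysis of the inertial iteration\<close>

lemma quadratic_form_identity:
  fixes a u v w z :: "'a::real_inner" and \<theta> d :: real
  shows "2 * inner (a - z) (v + \<theta> *\<^sub>R (v - u) - d *\<^sub>R (u - w) - a) =
      ((norm (v - z))\<^sup>2 - \<theta> * (norm (u - z))\<^sup>2 + d * (norm (w - z))\<^sup>2)
    - ((norm (a - z))\<^sup>2 - \<theta> * (norm (v - z))\<^sup>2 + d * (norm (u - z))\<^sup>2)
    - (1 - \<theta> - d) * (norm (a - v))\<^sup>2 + (2 * \<theta> + d) * (norm (v - u))\<^sup>2 + d * (norm (u - w))\<^sup>2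
    - \<theta> * (norm ((a - v) - (v - u)))\<^sup>2 - d * (norm ((v - u) + (u - w)))\<^sup>2
    - d * (norm ((a - v) + (u - w)))\<^sup>2"
proof -
  define p q r Z where "p = a - v" "q = v - u" "r = u - w" "Z = v - z"
  have "2 * inner (Z + p) (\<theta> *\<^sub>R q - d *\<^sub>R r - p) =
      ((norm Z)\<^sup>2 - \<theta> * (norm (Z - q))\<^sup>2 + d * (norm (Z - q - r))\<^sup>2)
    - ((norm (Z + p))\<^sup>2 - \<theta> * (norm Z)\<^sup>2 + d * (norm (Z - q))\<^sup>2)
    - (1 - \<theta> - d) * (norm p)\<^sup>2 + (2 * \<theta> + d) * (norm q)\<^sup>2 + d * (norm r)\<^sup>2
    - \<theta> * (norm (p - q))\<^sup>2 - d * (norm (q + r))\<^sup>2 - d * (norm (p + r))\<^sup>2"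
    unfolding power2_norm_eq_inner
    by (simp only: inner_add_left inner_add_right inner_diff_left inner_diff_right
        inner_scaleR_left inner_scaleR_right inner_commute[of p Z] inner_commute[of q Z]
        inner_commute[of r Z] inner_commute[of q p] inner_commute[of r p] inner_commute[of r q])
      algebra
  moreover have "Z + p = a - z" "\<theta> *\<^sub>R q - d *\<^sub>R r - p = v + \<theta> *\<^sub>R (v - u) - d *\<^sub>R (u - w) - a"
    "Z - q = u - z" "Z - q - r = w - z"
    by (simp_all add: p_q_r_Z_def)
  ultimately show ?thesis by (simp only: p_q_r_Z_def)
qed

text \<open>The operator enters only through \<open>step\<close>, which is monotonicity tested at a
  zero \<open>z\<close>.\<close>

lemma inertial_lyapunov:
  fixes X :: "nat \<Rightarrow> 'a::real_inner" and \<theta> d :: real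
  assumes \<theta>: "0 \<le> \<theta>" and d: "0 \<le> d" and small: "3 * \<theta> + 3 * d < 1"
    and step: "\<And>k. 0 \<le> inner (X (k + 3) - z)
      (X (k + 2) + \<theta> *\<^sub>R (X (k + 2) - X (k + 1)) - d *\<^sub>R (X (k + 1) - X k) - X (k + 3))"
  shows "bounded (range X)" "(\<lambda>k. X (Suc k) - X k) \<longlonglongrightarrow> 0"
    "convergent (\<lambda>k. (norm (X k - z))\<^sup>2)"
proof -
  define \<phi> where "\<phi> k = (norm (X k - z))\<^sup>2" for k
  define u where "u k = (norm (X (Suc k) - X k))\<^sup>2" for k
  \<comment> \<open>The identity leaves a surplus
    \<open>(2 * \<theta> + d) * u (k + 1) + d * u k\<close>. The \<open>u\<close> terms of
    \<open>W\<close> carry it forward until it is charged to \<open>u (k + 2)\<close>, lowering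
    \<open>1 - \<theta> - d\<close> by \<open>2 * \<theta> + 2 * d\<close>.\<close>
  define W where "W k = \<phi> (k + 2) - \<theta> * \<phi> (k + 1) + d * \<phi> k
      + (2 * \<theta> + 2 * d) * u (k + 1) + d * u k" for k
  have \<phi>0: "0 \<le> \<phi> k" and u0: "0 \<le> u k" for k by (auto simp: \<phi>_def u_def)
  have W_step: "W (Suc k) + (1 - 3 * \<theta> - 3 * d) * u (k + 2) \<le> W k" for k
  proof -
    have "0 \<le> \<theta> * (norm ((X (k+3) - X (k+2)) - (X (k+2) - X (k+1))))\<^sup>2"
      "0 \<le> d * (norm ((X (k+2) - X (k+1)) + (X (k+1) - X k)))\<^sup>2"
      "0 \<le> d * (norm ((X (k+3) - X (k+2)) + (X (k+1) - X k)))\<^sup>2"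
      using \<theta> d by auto
    with step[of k] have "0 \<le> (\<phi> (k+2) - \<theta> * \<phi> (k+1) + d * \<phi> k)
        - (\<phi> (k+3) - \<theta> * \<phi> (k+2) + d * \<phi> (k+1))
        - (1 - \<theta> - d) * u (k+2) + (2 * \<theta> + d) * u (k+1) + d * u k"
      using quadratic_form_identity[of "X (k+3)" z "X (k+2)" \<theta> "X (k+1)" d "X k"]
      by (simp add: \<phi>_def u_def eval_nat_numeral)
    then show ?thesis
      by (simp add: W_def eval_nat_numeral algebra_simps)
  qed
  have W_dec: "W (Suc k) \<le> W k" for k
  proof -
    have "0 \<le> (1 - 3 * \<theta> - 3 * d) * u (k + 2)"
      using small u0[of "k + 2"] by (intro mult_nonneg_nonneg) auto
    with W_step[of k] show ?thesis by linarith
  qed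
  then have "decseq W" by (rule decseq_SucI)
  then have W_le: "W k \<le> W 0" for k by (simp add: decseqD)
  have W_lower: "\<phi> (k + 2) - \<theta> * \<phi> (k + 1) \<le> W k" for k
    using \<theta> d \<phi>0 u0 by (simp add: W_def)
  \<comment> \<open>\<open>W 0 / (1 - \<theta>)\<close> is the fixed point of the map sending
    \<open>t\<close> to \<open>\<theta> * t + W 0\<close>, so a bound above it propagates;
    \<open>\<phi> 0\<close> and \<open>\<phi> 1\<close> start the induction.\<close>
  define B where "B = max (max (\<phi> 0) (\<phi> 1)) (W 0 / (1 - \<theta>))"
  have th1: "\<theta> < 1" using small d by linarith
  have B: "\<phi> (Suc k) \<le> B" for k
  proof (induction k)
    case (Suc k)
    have "\<phi> (Suc (Suc k)) \<le> \<theta> * \<phi> (Suc k) + W 0"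
      using W_lower[of k] W_le[of k] by (simp add: eval_nat_numeral)
    also have "\<theta> * \<phi> (Suc k) \<le> \<theta> * B" using Suc \<theta> by (intro mult_left_mono)
    also have "W 0 \<le> (1 - \<theta>) * B"
      using th1 by (simp add: B_def pos_divide_le_eq[symmetric] mult.commute[of "1 - \<theta>"] le_max_iff_disj)
    finally show ?case by (simp add: algebra_simps)
  qed (simp add: B_def)
  have B: "\<phi> k \<le> B" for k by (cases k) (use B in \<open>auto simp: B_def\<close>)
  have norm_le: "norm (X k - z) \<le> sqrt B" for k
    using B[of k] by (intro real_le_rsqrt) (simp add: \<phi>_def)
  have "norm (X k) \<le> sqrt B + norm z" for k
    using norm_le[of k] norm_triangle_sub[of "X k" z] by linarith
  then show "bounded (range X)" by (auto simp: bounded_iff)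
  have "- (\<theta> * B) \<le> W k" for k
    using W_lower[of k] \<phi>0[of "k + 2"] mult_left_mono[OF B \<theta>, of "k + 1"] by linarith
  then obtain L where L: "W \<longlonglongrightarrow> L"
    using decseq_convergent[OF \<open>decseq W\<close>] by blast
  have u_lim: "u \<longlonglongrightarrow> 0"
  proof -
    have "(\<lambda>k. (W k - W (Suc k)) / (1 - 3 * \<theta> - 3 * d)) \<longlonglongrightarrow> (L - L) / (1 - 3 * \<theta> - 3 * d)"
      using L small by (intro tendsto_intros LIMSEQ_Suc) auto
    then have lim: "(\<lambda>k. (W k - W (Suc k)) / (1 - 3 * \<theta> - 3 * d)) \<longlonglongrightarrow> 0" by simp
    have "(\<lambda>k. u (k + 2)) \<longlonglongrightarrow> 0"
    proof (rule Lim_null_comparison[OF _ lim], rule always_eventually, rule allI)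
      show "norm (u (k + 2)) \<le> (W k - W (Suc k)) / (1 - 3 * \<theta> - 3 * d)" for k
        using W_step[of k] u0[of "k + 2"] small by (simp add: pos_le_divide_eq mult.commute)
    qed
    then show ?thesis by (rule LIMSEQ_offset)
  qed
  then have norm_lim: "(\<lambda>k. norm (X (Suc k) - X k)) \<longlonglongrightarrow> 0"
    using tendsto_real_sqrt[OF u_lim] by (simp add: u_def)
  then show "(\<lambda>k. X (Suc k) - X k) \<longlonglongrightarrow> 0" by (rule tendsto_norm_zero_cancel)
  have diff_lim: "(\<lambda>k. \<phi> (Suc k) - \<phi> k) \<longlonglongrightarrow> 0"
  proof (rule Lim_null_comparison)
    show "(\<lambda>k. norm (X (Suc k) - X k) * (2 * sqrt B)) \<longlonglongrightarrow> 0"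
      using norm_lim by (rule tendsto_mult_left_zero)
    have "norm (\<phi> (Suc k) - \<phi> k) \<le> norm (X (Suc k) - X k) * (2 * sqrt B)" for k
    proof -
      have "\<phi> (Suc k) - \<phi> k = inner (X (Suc k) - X k) ((X (Suc k) - z) + (X k - z))"
        by (simp add: \<phi>_def power2_norm_eq_inner algebra_simps inner_commute)
      then have "norm (\<phi> (Suc k) - \<phi> k) \<le> norm (X (Suc k) - X k) * norm ((X (Suc k) - z) + (X k - z))"
        using Cauchy_Schwarz_ineq2 by simp
      also have "norm ((X (Suc k) - z) + (X k - z)) \<le> 2 * sqrt B"
        using norm_le[of k] norm_le[of "Suc k"] norm_triangle_ineq[of "X (Suc k) - z" "X k - z"] by linarith
      finally show ?thesis by (simp add: mult_left_mono)
    qed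
    then show "\<forall>\<^sub>F k in sequentially. norm (\<phi> (Suc k) - \<phi> k) \<le> norm (X (Suc k) - X k) * (2 * sqrt B)"
      by simp
  qed
  \<comment> \<open>Up to vanishing increments, \<open>\<phi> (k + 1)\<close> and
    \<open>\<phi> k\<close> equal \<open>\<phi> (k + 2)\<close>, so \<open>W k\<close> is
    \<open>(1 - \<theta> + d) * \<phi> (k + 2)\<close> plus null terms.\<close>
  have "(\<lambda>k. (W k - \<theta> * (\<phi> (Suc (Suc k)) - \<phi> (Suc k))
        + d * ((\<phi> (Suc (Suc k)) - \<phi> (Suc k)) + (\<phi> (Suc k) - \<phi> k))
        - (2 * \<theta> + 2 * d) * u (Suc k) - d * u k) / (1 - \<theta> + d))
      \<longlonglongrightarrow> (L - \<theta> * 0 + d * (0 + 0) - (2 * \<theta> + 2 * d) * 0 - d * 0) / (1 - \<theta> + d)"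
    using th1 d by (intro tendsto_intros L u_lim diff_lim
        LIMSEQ_Suc[OF diff_lim] LIMSEQ_Suc[OF u_lim]) auto
  moreover have "(W k - \<theta> * (\<phi> (Suc (Suc k)) - \<phi> (Suc k))
        + d * ((\<phi> (Suc (Suc k)) - \<phi> (Suc k)) + (\<phi> (Suc k) - \<phi> k))
        - (2 * \<theta> + 2 * d) * u (Suc k) - d * u k) / (1 - \<theta> + d) = \<phi> (k + 2)" for k
    using th1 d by (simp add: W_def field_simps)
  ultimately have "(\<lambda>k. \<phi> (k + 2)) \<longlonglongrightarrow> L / (1 - \<theta> + d)" by simp
  then have "\<phi> \<longlonglongrightarrow> L / (1 - \<theta> + d)" by (rule LIMSEQ_offset)
  then show "convergent (\<lambda>k. (norm (X k - z))\<^sup>2)"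
    unfolding \<phi>_def by (rule convergentI)
qed

section \<open>Weak convergence of the iterates\<close>

theorem theorem3p2:
  fixes A :: "'a::{real_inner, complete_space} \<Rightarrow> 'a set"
    and lam \<theta> \<delta> :: real
    and x :: "int \<Rightarrow> 'a"
    and y :: "nat \<Rightarrow> 'a"
  assumes "maximal_monotone A"
    and "op_zeros A \<noteq> {}"
    and "lam > 0"
    and "0 \<le> \<theta>" and "\<theta> < 1 / 3"
    and "(3 * \<theta> - 1) / (3 + 4 * \<theta>) < \<delta>" and "\<delta> \<le> 0"
    and "\<And>n::nat. x (int n + 1) = resolvent lam A (y n)"
    and "\<And>n::nat. y (n + 1) =
           x (int n + 1) + \<theta> *\<^sub>R (x (int n + 1) - x (int n))
                         + \<delta> *\<^sub>R (x (int n) - x (int n - 1))"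
  shows "\<exists>p\<in>op_zeros A. converges_weakly (\<lambda>n. x (int n)) p"
proof -
  define d where "d = - \<delta>"
  have d: "0 \<le> d" using assms by (simp add: d_def)
  \<comment> \<open>Discarding \<open>4 * \<delta> * \<theta> \<le> 0\<close> will leave
    \<open>3 * \<theta> - 1 < 3 * \<delta>\<close>.\<close>
  have "3 * \<theta> - 1 < \<delta> * (3 + 4 * \<theta>)"
    using assms(4,6) by (simp add: pos_divide_less_eq)
  moreover have "\<delta> * \<theta> \<le> 0" using assms(4,7) by (rule mult_nonpos_nonneg[rotated])
  ultimately have small: "3 * \<theta> + 3 * d < 1"
    by (simp add: d_def algebra_simps)
  define X where "X k = x (int k - 1)" for k \<comment> \<open>the index starts at \<open>x\<^sub>-\<^sub>1\<close>\<close>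
  \<comment> \<open>\<open>e k\<close> is \<open>y (k + 1)\<close> minus its resolvent, hence
    \<open>lam\<close> times an element of \<open>A (X (k + 3))\<close>. It starts with
    \<open>y 1\<close> because \<open>y 0\<close> is arbitrary.\<close>
  define e where "e k = X (k + 2) + \<theta> *\<^sub>R (X (k + 2) - X (k + 1)) - d *\<^sub>R (X (k + 1) - X k) - X (k + 3)" for k
  have e_mem: "(1 / lam) *\<^sub>R e k \<in> A (X (k + 3))" for k
  proof -
    have "X (k + 3) = resolvent lam A (y (k + 1))"
      using assms(8)[of "k + 1"] by (simp add: X_def add.commute)
    moreover have "e k = y (k + 1) - X (k + 3)"
      using assms(9)[of k] by (simp add: e_def X_def d_def add.commute)
    ultimately show ?thesis using resolvent_mem[OF assms(1,3)] by metis
  qed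
  have mono: "inner (a - b) (f - g) \<ge> 0" if "f \<in> A a" "g \<in> A b" for a b f g
    using assms(1) that by (auto simp: maximal_monotone_def monotone_operator_def)
  have step: "0 \<le> inner (X (k + 3) - z) (e k)" if "z \<in> op_zeros A" for z k
    using mono[OF e_mem, of 0 z k] that assms(3) by (simp add: op_zeros_def zero_le_divide_iff)
  note lyap = inertial_lyapunov[OF assms(4) d small, OF step[unfolded e_def]]
  obtain z0 where z0: "z0 \<in> op_zeros A" using assms(2) by blast
  note bdd = lyap(1)[OF z0]
  have incr: "(\<lambda>k. X (Suc k) - X k) \<longlonglongrightarrow> 0" using lyap(2)[OF z0] .
  have e_lim: "e \<longlonglongrightarrow> 0"
  proof -
    have "(\<lambda>k. - (X (Suc (k + 2)) - X (k + 2)) + \<theta> *\<^sub>R (X (Suc (k + 1)) - X (k + 1)) - d *\<^sub>R (X (Suc k) - X k))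
        \<longlonglongrightarrow> - 0 + \<theta> *\<^sub>R 0 - d *\<^sub>R 0"
      by (intro tendsto_intros incr LIMSEQ_ignore_initial_segment[OF incr])
    moreover have "e = (\<lambda>k. - (X (Suc (k + 2)) - X (k + 2)) + \<theta> *\<^sub>R (X (Suc (k + 1)) - X (k + 1)) - d *\<^sub>R (X (Suc k) - X k))"
      by (simp add: e_def fun_eq_iff eval_nat_numeral)
    ultimately show ?thesis by simp
  qed
  obtain M where M: "\<And>k. norm (X k) \<le> M" using bdd by (auto simp: bounded_iff)
  have hull: "p \<in> op_zeros A" if p: "hull_point X p" for p
  proof -
    \<comment> \<open>Monotonicity against \<open>(a, f)\<close> puts the iterates, up to an error
      of order \<open>norm (e k)\<close>, in a half-space bounded by \<open>inner f a\<close>. Hull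
      points inherit the bound, and maximality then yields \<open>0 \<in> A p\<close>.\<close>
    have "0 \<le> inner (p - a) (0 - f)" if f: "f \<in> A a" for a f
    proof -
      have "inner f p \<le> inner f a"
      proof (rule field_le_epsilon)
        fix \<epsilon> :: real assume "0 < \<epsilon>"
        have lim: "(\<lambda>k. (M + norm a) * ((1 / lam) * norm (e k))) \<longlonglongrightarrow> (M + norm a) * ((1 / lam) * norm (0::'a))"
          by (intro tendsto_intros e_lim)
        have "\<forall>\<^sub>F k in sequentially. (M + norm a) * ((1 / lam) * norm (e k)) < \<epsilon>"
          by (rule order_tendstoD(2)[OF lim]) (use \<open>0 < \<epsilon>\<close> in simp)
        then have "\<forall>\<^sub>F k in sequentially. inner f (X (k + 3)) \<le> inner f a + \<epsilon>"
        proof (rule eventually_mono)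
          fix k assume k: "(M + norm a) * ((1 / lam) * norm (e k)) < \<epsilon>"
          have "inner (X (k + 3) - a) ((1 / lam) *\<^sub>R e k) \<le> norm (X (k + 3) - a) * norm ((1 / lam) *\<^sub>R e k)"
            by (rule norm_cauchy_schwarz)
          also have "\<dots> = norm (X (k + 3) - a) * ((1 / lam) * norm (e k))"
            using assms(3) by simp
          also have "\<dots> \<le> (M + norm a) * ((1 / lam) * norm (e k))"
            using M[of "k + 3"] norm_triangle_ineq4[of "X (k + 3)" a] assms(3)
            by (intro mult_right_mono) auto
          finally show "inner f (X (k + 3)) \<le> inner f a + \<epsilon>"
            using mono[OF e_mem f, of k] k
            by (simp add: inner_diff_right inner_diff_left inner_commute)
        qed
        then have "\<forall>\<^sub>F k in sequentially. inner f (X k) \<le> inner f a + \<epsilon>"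
          by (subst (asm) eventually_sequentially_seg)
        then show "inner f p \<le> inner f a + \<epsilon>"
          using p bounded_linear_inner_right by (auto simp: hull_point_def)
      qed
      then show ?thesis by (simp add: inner_commute[of _ f] inner_diff_right)
    qed
    then show ?thesis
      using maximal_monotoneD[OF assms(1), of p 0] by (simp add: op_zeros_def)
  qed
  obtain p where p: "p \<in> op_zeros A" "converges_weakly X p"
    using opial[OF bdd hull] lyap(3) by blast
  \<comment> \<open>Dropping the first term of \<open>X\<close> undoes its offset.\<close>
  have "(\<lambda>n. x (int n)) = (\<lambda>n. X (Suc n))" by (simp add: X_def)
  then show ?thesis
    using p by (auto simp: converges_weakly_def intro!: bexI[of _ p] LIMSEQ_Suc)
qed

end
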